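(* Let $(X,T)$ be a fixed-point free dynamical system. Then $\mathrm{ind}_p\, P_p(X)$ is finite for all prime numbers $p$, and the sequence $\mathrm{ind}_p\, P_p(X)$ ($p=2,3,5,7,11,\dots$) has at most linear growth, namely there exists a positive number $C$ (independent of $p$) such that $$\mathrm{ind}_p\, P_p(X) < C\cdot p$$ for all prime numbers $p$.
   Context: A dynamical system is a pair $(X,T)$ where $X$ is a compact metrizable space and $T:X\to X$ is a homeomorphism. For $n\geq 1$, $P_n(X)=P_n(X,T):=\{x\in X\mid T^n x=x\}$. The system is fixed-point free if $P_1(X,T)=\emptyset$. Let $p$ be a prime and $\mathbb{Z}_p:=\mathbb{Z}/p\mathbb{Z}$. A $\mathbb{Z}_p$-space is a pair $(Y,S)$ where $Y$ is a topological space and $S:Y\to Y$ is a homeomorphism with $S^p=\mathrm{id}$. It is free if $S^a y\neq y$ for all $1\leq a\leq p-1$ and $y\in Y$ (equivalently, $Sy\neq y$ for all $y\in Y$). A map $f$ between $\mathbb{Z}_p$-spaces $(Y,S)$ and $(Y',S')$ is equivariant if $f\circ S=S'\circ f$. If $(X,T)$ is fixed-point free, $(P_p(X,T),T)$ is a free $\mathbb{Z}_p$-space. For an integer $n\geq 0$, a free $\mathbb{Z}_p$-space $(Y,S)$ is called an $E_n\mathbb{Z}_p$-space if $Y$ is an $n$-dimensional finite simplicial complex, $S$ is a simplicial map (mapping each simplex affinely to a simplex), and $Y$ is $(n-1)$-connected ($\pi_k(Y)$ vanishes for $0\leq k\leq n-1$; any nonempty space is considered $(-1)$-connected). For example, the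 join of $n+1$ copies of the discrete space $\mathbb{Z}_p$ with the simultaneous translation action is an $E_n\mathbb{Z}_p$-space. Any $E_n\mathbb{Z}_p$-space admits an equivariant continuous map to any other, so below $E_n\mathbb{Z}_p$ denotes any one of them. For a free $\mathbb{Z}_p$-space $(Y,S)$, $\mathrm{ind}_p(Y,S)=\mathrm{ind}_p Y$ is the minimum $n\geq 0$ such that there is a $\mathbb{Z}_p$-equivariant continuous map $Y\to E_n\mathbb{Z}_p$; it is $\infty$ if no such $n$ exists; and by convention $\mathrm{ind}_p\emptyset=-1$. *)

theory Defs
  imports "HOL-Analysis.Analysis" "HOL-Computational_Algebra.Primes"
begin

section \<open>Dynamical systems\<close>

definition dynamical_system :: "'a topology \<Rightarrow> ('a \<Rightarrow> 'a) \<Rightarrow> bool" where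
  "dynamical_system X T \<longleftrightarrow>
     compact_space X \<and> metrizable_space X \<and> homeomorphic_map X X T"

definition periodic_points :: "'a topology \<Rightarrow> ('a \<Rightarrow> 'a) \<Rightarrow> nat \<Rightarrow> 'a topology" where
  "periodic_points X T n = subtopology X {x \<in> topspace X. (T ^^ n) x = x}"

definition fixed_point_free :: "'a topology \<Rightarrow> ('a \<Rightarrow> 'a) \<Rightarrow> bool" where
  "fixed_point_free X T \<longleftrightarrow> topspace (periodic_points X T 1) = {}"

section \<open>Spaces with an action of the integers modulo p\<close>

definition Zp_space :: "nat \<Rightarrow> 'a topology \<Rightarrow> ('a \<Rightarrow> 'a) \<Rightarrow> bool" where
  "Zp_space p Y S \<longleftrightarrow> homeomorphic_map Y Y S \<and> (\<forall>y \<in> topspace Y. (S ^^ p) y = y)"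

definition free_Zp_space :: "nat \<Rightarrow> 'a topology \<Rightarrow> ('a \<Rightarrow> 'a) \<Rightarrow> bool" where
  "free_Zp_space p Y S \<longleftrightarrow>
     Zp_space p Y S \<and> (\<forall>a \<in> {1..p - 1}. \<forall>y \<in> topspace Y. (S ^^ a) y \<noteq> y)"

definition equivariant_map ::
  "'a topology \<Rightarrow> ('a \<Rightarrow> 'a) \<Rightarrow> 'b topology \<Rightarrow> ('b \<Rightarrow> 'b) \<Rightarrow> ('a \<Rightarrow> 'b) \<Rightarrow> bool" where
  "equivariant_map Y S Y' S' f \<longleftrightarrow>
     continuous_map Y Y' f \<and> (\<forall>y \<in> topspace Y. f (S y) = S' (f y))"

section \<open>Finite simplicial complexes\<close>

text \<open>
  A finite simplicial complex is given by its nonempty faces on vertices of type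
  \<^typ>\<open>nat\<close>, and its underlying space is the geometric realization in barycentric
  coordinates. This covers all finite simplicial complexes up to simplicial isomorphism and,
  unlike \<^const>\<open>simplicial_complex\<close>, puts complexes of every dimension into one type.
  As the complex is finite, the topology of pointwise convergence agrees with the usual one.
\<close>

definition finite_complex :: "nat set set \<Rightarrow> bool" where
  "finite_complex K \<longleftrightarrow>
     finite K \<and> (\<forall>s \<in> K. finite s \<and> s \<noteq> {}) \<and>
     (\<forall>s \<in> K. \<forall>t. t \<subseteq> s \<and> t \<noteq> {} \<longrightarrow> t \<in> K)"

definition closed_simplex :: "nat set \<Rightarrow> (nat \<Rightarrow> real) set" where
  "closed_simplex s = {x. (\<forall>v. 0 \<le> x v) \<and> (\<forall>v. v \<notin> s \<longrightarrow> x v = 0) \<and> (\<Sum>v\<in>s. x v) = 1}"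

definition realization :: "nat set set \<Rightarrow> (nat \<Rightarrow> real) topology" where
  "realization K = subtopology (powertop_real UNIV) (\<Union>s\<in>K. closed_simplex s)"

definition has_dimension :: "nat set set \<Rightarrow> nat \<Rightarrow> bool" where
  "has_dimension K n \<longleftrightarrow> (\<exists>s \<in> K. card s = n + 1) \<and> (\<forall>s \<in> K. card s \<le> n + 1)"

text \<open>
  Each simplex is mapped affinely onto a simplex. Since the singletons of vertices are
  themselves simplices, vertices are mapped to vertices.
\<close>

definition simplicial_self_map :: "nat set set \<Rightarrow> ((nat \<Rightarrow> real) \<Rightarrow> (nat \<Rightarrow> real)) \<Rightarrow> bool" where
  "simplicial_self_map K S \<longleftrightarrow>
     (\<forall>s \<in> K. (\<exists>t \<in> K. S ` closed_simplex s = closed_simplex t) \<and>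
       (\<forall>x \<in> closed_simplex s. \<forall>y \<in> closed_simplex s. \<forall>u \<in> {0..1}.
          S (\<lambda>v. (1 - u) * x v + u * y v) = (\<lambda>v. (1 - u) * S x v + u * S y v)))"

section \<open>Homotopy groups and connectivity\<close>

definition cube_set :: "nat \<Rightarrow> (nat \<Rightarrow> real) set" where
  "cube_set k = {x \<in> topspace (Euclidean_space k). \<forall>i<k. 0 \<le> x i \<and> x i \<le> 1}"

definition cube_boundary :: "nat \<Rightarrow> (nat \<Rightarrow> real) set" where
  "cube_boundary k = {x \<in> cube_set k. \<exists>i<k. x i = 0 \<or> x i = 1}"

definition cube :: "nat \<Rightarrow> (nat \<Rightarrow> real) topology" where
  "cube k = subtopology (Euclidean_space k) (cube_set k)"

text \<open>
  Elements of the \<open>k\<close>-th homotopy group at \<open>b\<close> are homotopy classes of maps of pairs from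
  the \<open>k\<close>-cube and its boundary to \<open>(Y, {b})\<close>. The boundary of the \<open>0\<close>-cube is empty, so
  for \<open>k = 0\<close> this is the set of path components.
\<close>

definition homotopy_group_vanishes :: "nat \<Rightarrow> 'a topology \<Rightarrow> 'a \<Rightarrow> bool" where
  "homotopy_group_vanishes k Y b \<longleftrightarrow>
     (\<forall>f. continuous_map (cube k) Y f \<and> f ` cube_boundary k \<subseteq> {b} \<longrightarrow>
        homotopic_with (\<lambda>g. g ` cube_boundary k \<subseteq> {b}) (cube k) Y f (\<lambda>_. b))"

text \<open>This is \<open>(n - 1)\<close>-connectedness, indexed by \<open>n\<close> so as to include \<open>(-1)\<close>.\<close>

definition connected_below :: "nat \<Rightarrow> 'a topology \<Rightarrow> bool" where
  "connected_below n Y \<longleftrightarrow>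
     topspace Y \<noteq> {} \<and> (\<forall>k<n. \<forall>b \<in> topspace Y. homotopy_group_vanishes k Y b)"

section \<open>The index\<close>

definition EnZp_space :: "nat \<Rightarrow> nat \<Rightarrow> nat set set \<Rightarrow> ((nat \<Rightarrow> real) \<Rightarrow> (nat \<Rightarrow> real)) \<Rightarrow> bool" where
  "EnZp_space n p K S \<longleftrightarrow>
     finite_complex K \<and> has_dimension K n \<and> simplicial_self_map K S \<and>
     free_Zp_space p (realization K) S \<and> connected_below n (realization K)"

text \<open>
  Any two of these spaces for the same \<open>n\<close> and \<open>p\<close> map equivariantly to each other, so it
  does not matter which one is the target.
\<close>

definition maps_to_EnZp :: "nat \<Rightarrow> nat \<Rightarrow> 'a topology \<Rightarrow> ('a \<Rightarrow> 'a) \<Rightarrow> bool" where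
  "maps_to_EnZp n p Y S \<longleftrightarrow>
     (\<exists>K S' f. EnZp_space n p K S' \<and> equivariant_map Y S (realization K) S' f)"

definition ind :: "nat \<Rightarrow> 'a topology \<Rightarrow> ('a \<Rightarrow> 'a) \<Rightarrow> ereal" where
  "ind p Y S =
     (if topspace Y = {} then -1
      else if \<exists>n. maps_to_EnZp n p Y S then ereal (real (LEAST n. maps_to_EnZp n p Y S))
      else \<infinity>)"

end

theory Submission
  imports Defs "HOL-Number_Theory.Cong"
begin

text \<open>
  By compactness there are \<open>M\<close> real functions \<open>f i\<close> on \<open>X\<close> such that every \<open>x\<close> has some \<open>i\<close> with
  \<open>f i x \<noteq> f i (T x)\<close>. So for a point \<open>x\<close> of period \<open>p\<close> one of the \<open>M\<close> cyclic sequences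
  \<open>b \<mapsto> f i (T\<^sup>b x)\<close>, \<open>b < p\<close>, is not constant, and some proper nonempty set of positions
  carries its largest values. For fixed \<open>i\<close> and size \<open>k\<close> there is at most one such set, and as \<open>p\<close> is
  prime, the sets of size \<open>k\<close> have an equivariant label in the integers modulo \<open>p\<close>. This maps the
  periodic points equivariantly to the join of \<open>M * (p - 1)\<close> copies of \<open>p\<close> points.

  The join of \<open>N\<close> copies is the \<open>N\<close>-th power of the cone over \<open>p\<close> points without the apex,
  up to normalization. As the power of a tree is contractible, a map of a cube to the join contracts
  there, and as the parameter space has dimension less than \<open>N\<close>, the homotopy can be
  pushed off the apex.
\<close>

section \<open>The join of discrete sets\<close>

text \<open>
  The join of \<open>N\<close> copies of a discrete set with \<open>p\<close> points: the vertex \<open>j * p + a\<close> is the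
  point \<open>a\<close> of the \<open>j\<close>-th copy, called column \<open>a\<close> of row \<open>j\<close>.
\<close>

definition join_complex :: "nat \<Rightarrow> nat \<Rightarrow> nat set set" where
  "join_complex p N = {s. s \<noteq> {} \<and> s \<subseteq> {..<N * p} \<and> inj_on (\<lambda>v. v div p) s}"

text \<open>The group acts on points by \<open>x \<circ> shift p\<close>, hence on vertices by the
  inverse of \<open>shift p\<close>; this is why preimages of simplices appear below.\<close>

definition shift :: "nat \<Rightarrow> nat \<Rightarrow> nat" where
  "shift p v = v div p * p + (v mod p + 1) mod p"

lemma finite_join_simplex: "s \<in> join_complex p N \<Longrightarrow> finite s"
  by (auto simp: join_complex_def intro: finite_subset)

lemma finite_complex_join: "finite_complex (join_complex p N)"
proof -
  have "finite (join_complex p N)"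
    by (rule finite_subset[of _ "Pow {..<N * p}"]) (auto simp: join_complex_def)
  then show ?thesis
    using finite_join_simplex unfolding finite_complex_def join_complex_def
    by (blast intro: inj_on_subset)
qed

text \<open>A simplex has at most one vertex in each row, and column \<open>0\<close> of all
  \<open>N\<close> rows together is a simplex of that maximal size.\<close>

lemma has_dimension_join:
  assumes "0 < p" "0 < N"
  shows "has_dimension (join_complex p N) (N - 1)"
proof -
  have "card s \<le> N" if "s \<in> join_complex p N" for s
  proof -
    have "(\<lambda>v. v div p) ` s \<subseteq> {..<N}"
      using that by (auto simp: join_complex_def less_mult_imp_div_less)
    then show ?thesis
      using that card_inj_on_le[of "\<lambda>v. v div p" s "{..<N}"] by (auto simp: join_complex_def)
  qed
  moreover have "(\<lambda>j. j * p) ` {..<N} \<in> join_complex p N"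
    using assms by (auto simp: join_complex_def inj_on_def)
  moreover have "card ((\<lambda>j. j * p) ` {..<N}) = N"
    using assms by (subst card_image) (auto simp: inj_on_def)
  ultimately show ?thesis
    unfolding has_dimension_def using assms by (metis Suc_eq_plus1 Suc_pred')
qed

lemma in_closed_simplex_superset:
  assumes "finite t" "s \<subseteq> t"
  shows "x \<in> closed_simplex s \<longleftrightarrow>
    (\<forall>v. 0 \<le> x v) \<and> (\<forall>v. v \<notin> s \<longrightarrow> x v = 0) \<and> (\<Sum>v\<in>t. x v) = 1"
proof -
  have "(\<Sum>v\<in>s. x v) = (\<Sum>v\<in>t. x v)" if "\<forall>v. v \<notin> s \<longrightarrow> x v = 0"
    using assms that by (intro sum.mono_neutral_left) auto
  then show ?thesis
    unfolding closed_simplex_def by auto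
qed

text \<open>The support of a point is the smallest simplex that contains it, so membership can be
  read off the coordinates: no row has two positive ones. Maps into the join are later checked in
  this form.\<close>

lemma topspace_realization_join:
  "x \<in> topspace (realization (join_complex p N)) \<longleftrightarrow>
     (\<forall>v. 0 \<le> x v) \<and> (\<forall>v\<ge>N * p. x v = 0) \<and> (\<Sum>v<N * p. x v) = 1 \<and>
     (\<forall>v w. 0 < x v \<and> 0 < x w \<and> v div p = w div p \<longrightarrow> v = w)" (is "?L \<longleftrightarrow> ?R")
proof
  assume ?L
  then obtain s where s: "s \<in> join_complex p N" "x \<in> closed_simplex s"
    by (auto simp: realization_def)
  then have sub: "s \<subseteq> {..<N * p}" and inj: "inj_on (\<lambda>v. v div p) s"
    by (auto simp: join_complex_def)
  note x = s(2)[unfolded in_closed_simplex_superset[OF finite_lessThan sub]]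
  have "v \<in> s" if "0 < x v" for v
    using x that by (metis less_irrefl)
  with x sub inj show ?R
    by (auto simp: inj_on_def subset_iff not_less)
next
  assume R: ?R
  define s where "s = {v. 0 < x v}"
  have sub: "s \<subseteq> {..<N * p}"
    using R by (force simp: s_def not_le)
  have "s \<noteq> {}"
  proof
    assume "s = {}"
    then have "x v = 0" for v
      using R by (metis (mono_tags, lifting) empty_iff mem_Collect_eq order_le_less s_def)
    then show False
      using R by simp
  qed
  moreover have "inj_on (\<lambda>v. v div p) s"
    using R unfolding inj_on_def s_def by blast
  ultimately have "s \<in> join_complex p N"
    using sub unfolding join_complex_def by blast
  moreover have "x v = 0" if "v \<notin> s" for v
    using R that unfolding s_def by (metis mem_Collect_eq order_le_less)
  then have "x \<in> closed_simplex s"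
    unfolding in_closed_simplex_superset[OF finite_lessThan sub] using R by blast
  ultimately show ?L
    by (auto simp: realization_def)
qed

text \<open>Turns points of the product of cones other than the apex into points of the join: the
  sum is positive there, so division by it is continuous. Both the null homotopies and the map on
  periodic points are built in this way.\<close>

lemma continuous_map_normalize:
  assumes cont: "\<And>v. v < N * p \<Longrightarrow> continuous_map Z euclideanreal (G v)"
    and nonneg: "\<And>v z. v < N * p \<Longrightarrow> z \<in> topspace Z \<Longrightarrow> 0 \<le> G v z"
    and pos: "\<And>z. z \<in> topspace Z \<Longrightarrow> \<exists>v<N * p. 0 < G v z"
    and disj: "\<And>v w z. \<lbrakk>v < N * p; w < N * p; z \<in> topspace Z; 0 < G v z; 0 < G w z; v div p = w div p\<rbrakk>
      \<Longrightarrow> v = w"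
  shows "continuous_map Z (realization (join_complex p N))
    (\<lambda>z v. if v < N * p then G v z / (\<Sum>w<N * p. G w z) else 0)"
proof -
  let ?F = "\<lambda>z v. if v < N * p then G v z / (\<Sum>w<N * p. G w z) else 0"
  have sum_pos: "0 < (\<Sum>w<N * p. G w z)" if z: "z \<in> topspace Z" for z
  proof -
    obtain v where "v < N * p" "0 < G v z"
      using pos z by blast
    then show ?thesis
      using nonneg z by (intro sum_pos2[of _ v]) auto
  qed
  have "continuous_map Z (powertop_real UNIV) ?F"
    unfolding continuous_map_componentwise_UNIV
  proof
    fix v
    show "continuous_map Z euclideanreal (\<lambda>z. ?F z v)"
    proof (cases "v < N * p")
      case True
      have "continuous_map Z euclideanreal (\<lambda>z. G v z / (\<Sum>w<N * p. G w z))"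
        using cont True sum_pos by (intro continuous_map_real_divide continuous_map_sum) force+
      with True show ?thesis
        by simp
    qed simp
  qed
  moreover have "?F z \<in> topspace (realization (join_complex p N))" if z: "z \<in> topspace Z" for z
  proof -
    have "0 < G v z" "v < N * p" if "0 < ?F z v" for v
      using that sum_pos[OF z] by (auto simp: zero_less_divide_iff split: if_splits)
    then have "v = w" if "0 < ?F z v \<and> 0 < ?F z w \<and> v div p = w div p" for v w
      using disj[OF _ _ z] that by blast
    moreover have "?F z v = 0" if "N * p \<le> v" for v
      using that by simp
    moreover have "0 \<le> ?F z v" for v
      using nonneg[OF _ z] sum_pos[OF z] by (auto intro: divide_nonneg_pos)
    moreover have "(\<Sum>v<N * p. ?F z v) = 1"
      using sum_pos[OF z] by (simp flip: sum_divide_distrib)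
    ultimately show ?thesis
      unfolding topspace_realization_join by (intro conjI allI impI) blast+
  qed
  then have "?F \<in> topspace Z \<rightarrow> (\<Union>s\<in>join_complex p N. closed_simplex s)"
    by (auto simp: realization_def)
  ultimately show ?thesis
    unfolding realization_def continuous_map_in_subtopology by blast
qed

section \<open>The cyclic action on the join\<close>

lemma shift_div: "0 < p \<Longrightarrow> shift p v div p = v div p"
  and shift_mod: "0 < p \<Longrightarrow> shift p v mod p = (v mod p + 1) mod p"
  by (simp_all add: shift_def)

lemma funpow_shift_div: "0 < p \<Longrightarrow> (shift p ^^ a) v div p = v div p"
  by (induction a) (simp_all add: shift_div)

lemma funpow_shift_mod: "0 < p \<Longrightarrow> (shift p ^^ a) v mod p = (v mod p + a) mod p"
  by (induction a) (simp_all add: shift_mod mod_Suc_eq)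

lemma div_mod_eqI: "v div p = w div p \<Longrightarrow> v mod p = w mod p \<Longrightarrow> v = (w :: nat)"
  by (metis div_mult_mod_eq)

lemma funpow_shift_self: "0 < p \<Longrightarrow> (shift p ^^ p) v = v"
  by (rule div_mod_eqI[of _ p]) (simp_all add: funpow_shift_div funpow_shift_mod)

lemma bij_shift: assumes "0 < p" shows "bij (shift p)"
proof -
  obtain k where k: "p = Suc k"
    using assms gr0_implies_Suc by blast
  have id: "(shift p ^^ p) = id"
    using funpow_shift_self[OF assms] by auto
  show ?thesis
  proof (rule o_bij)
    show "(shift p ^^ k) \<circ> shift p = id"
      using id unfolding k funpow_Suc_right .
    show "shift p \<circ> (shift p ^^ k) = id"
      using id unfolding k by simp
  qed
qed

lemma shift_less_iff: "0 < p \<Longrightarrow> shift p v < N * p \<longleftrightarrow> v < N * p"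
  by (simp add: shift_div flip: div_less_iff_less_mult)

lemma bij_betw_shift: "0 < p \<Longrightarrow> bij_betw (shift p) {..<N * p} {..<N * p}"
  using bij_shift[of p] shift_less_iff[of p]
  by (intro bij_betw_imageI endo_inj_surj) (auto simp: bij_def intro: inj_on_subset)

lemma closed_simplex_shift:
  assumes "0 < p" "finite s"
  shows "(\<lambda>x. x \<circ> shift p) ` closed_simplex s = closed_simplex (shift p -` s)"
proof -
  have surj: "surj (shift p)"
    using bij_shift[OF assms(1)] by (simp add: bij_is_surj)
  have bij: "bij_betw (shift p) (shift p -` s) s"
    using bij_shift[OF assms(1)] by (auto simp: bij_betw_def bij_def inj_on_def surj_image_vimage_eq)
  have fwd: "x \<circ> shift p \<in> closed_simplex (shift p -` s) \<longleftrightarrow> x \<in> closed_simplex s" for x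
  proof -
    have "(\<forall>v. P (shift p v)) \<longleftrightarrow> (\<forall>v. P v)" for P
      using surj by (metis surjD)
    from this[of "\<lambda>v. 0 \<le> x v"] this[of "\<lambda>v. v \<notin> s \<longrightarrow> x v = 0"] show ?thesis
      using sum.reindex_bij_betw[OF bij, of x] by (simp add: closed_simplex_def)
  qed
  show ?thesis
  proof (intro equalityI subsetI)
    fix y assume y: "y \<in> closed_simplex (shift p -` s)"
    have "y = (y \<circ> inv (shift p)) \<circ> shift p"
      using bij_shift[OF assms(1)] by (auto simp: bij_def)
    with y fwd show "y \<in> (\<lambda>x. x \<circ> shift p) ` closed_simplex s"
      by (metis image_eqI)
  qed (use fwd in auto)
qed

lemma shift_vimage_join:
  assumes "0 < p" "s \<in> join_complex p N"
  shows "shift p -` s \<in> join_complex p N"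
proof -
  have "inj_on (\<lambda>v. v div p) (shift p -` s)"
  proof (rule inj_onI)
    fix v w assume vw: "v \<in> shift p -` s" "w \<in> shift p -` s" "v div p = w div p"
    have "inj_on (\<lambda>v. v div p) s"
      using assms(2) by (simp add: join_complex_def)
    then have "shift p v = shift p w"
      by (rule inj_onD) (use vw in \<open>simp_all add: shift_div[OF assms(1)]\<close>)
    then show "v = w"
      by (rule injD[OF bij_is_inj[OF bij_shift[OF assms(1)]]])
  qed
  moreover have "shift p -` s \<noteq> {}"
    using assms(2) surj_image_vimage_eq[OF bij_is_surj[OF bij_shift[OF assms(1)]], of s]
    unfolding join_complex_def by force
  moreover have "shift p -` s \<subseteq> {..<N * p}"
    using assms shift_less_iff[OF assms(1)] by (auto simp: join_complex_def)
  ultimately show ?thesis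
    by (simp add: join_complex_def)
qed

lemma simplicial_self_map_shift:
  assumes "0 < p"
  shows "simplicial_self_map (join_complex p N) (\<lambda>x. x \<circ> shift p)"
  unfolding simplicial_self_map_def
proof (intro ballI conjI)
  fix s assume s: "s \<in> join_complex p N"
  show "\<exists>t\<in>join_complex p N. (\<lambda>x. x \<circ> shift p) ` closed_simplex s = closed_simplex t"
    using closed_simplex_shift[OF assms finite_join_simplex[OF s]] shift_vimage_join[OF assms s] by blast
qed (simp only: comp_def)

lemma funpow_comp_right:
  fixes f :: "'a \<Rightarrow> 'a"
  shows "((\<lambda>x. x \<circ> f) ^^ a) x = x \<circ> (f ^^ a)"
proof (induction a)
  case (Suc a)
  have "((\<lambda>x. x \<circ> f) ^^ Suc a) x = (x \<circ> (f ^^ a)) \<circ> f"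
    unfolding funpow.simps comp_apply Suc.IH ..
  also have "\<dots> = x \<circ> (f ^^ Suc a)"
    unfolding funpow_Suc_right comp_assoc ..
  finally show ?case .
qed simp

lemma continuous_map_comp_realization:
  assumes "\<And>x. x \<in> topspace (realization K) \<Longrightarrow> x \<circ> f \<in> topspace (realization L)"
  shows "continuous_map (realization K) (realization L) (\<lambda>x. x \<circ> f)"
proof -
  have "continuous_map (realization K) (powertop_real UNIV) (\<lambda>x. x \<circ> f)"
    unfolding continuous_map_componentwise_UNIV realization_def comp_def
    by (intro allI continuous_map_from_subtopology continuous_map_product_projection) simp
  then show ?thesis
    using assms unfolding realization_def continuous_map_in_subtopology by auto
qed

text \<open>Freeness: a point fixed by the \<open>a\<close>-th power has positive coordinates at
  some \<open>v\<close> and at \<open>(shift p ^^ a) v\<close>. These lie in one row and hence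
  agree, so \<open>p\<close> divides \<open>a\<close>.\<close>

lemma free_Zp_space_join:
  assumes "0 < p"
  shows "free_Zp_space p (realization (join_complex p N)) (\<lambda>x. x \<circ> shift p)"
proof -
  let ?Y = "realization (join_complex p N)" and ?S = "\<lambda>x :: nat \<Rightarrow> real. x \<circ> shift p"
  obtain k where k: "p = Suc k"
    using assms gr0_implies_Suc by blast
  have Sp: "(?S ^^ p) x = x" for x
    unfolding funpow_comp_right using funpow_shift_self[OF assms] by (auto simp: fun_eq_iff)
  have "x \<circ> shift p \<in> topspace ?Y" if x: "x \<in> topspace ?Y" for x
  proof -
    have inj: "shift p v = shift p w \<Longrightarrow> v = w" for v w
      using bij_shift[OF assms] by (simp add: bij_def inj_def)
    have "(\<Sum>v<N * p. x (shift p v)) = 1"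
      using sum.reindex_bij_betw[OF bij_betw_shift[OF assms], of x] x
      by (simp add: topspace_realization_join)
    moreover have "x (shift p v) = 0" if "v \<ge> N * p" for v
      using x that shift_less_iff[OF assms, of v N] by (simp add: topspace_realization_join not_less)
    moreover have "v = w" if "0 < x (shift p v)" "0 < x (shift p w)" "v div p = w div p" for v w
      using x that inj shift_div[OF assms] unfolding topspace_realization_join by metis
    moreover have "0 \<le> x v" for v
      using x unfolding topspace_realization_join by blast
    ultimately show ?thesis
      unfolding topspace_realization_join by simp
  qed
  then have cont: "continuous_map ?Y ?Y ?S"
    by (rule continuous_map_comp_realization)
  have cont_a: "continuous_map ?Y ?Y (?S ^^ a)" for a
  proof (induction a)
    case 0
    show ?case
      using continuous_map_id by simp
  next
    case (Suc a)
    from continuous_map_compose[OF Suc cont] show ?case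
      unfolding funpow.simps .
  qed
  \<comment> \<open>With \<open>p = Suc k\<close>, the power \<open>k\<close> of the map is its
    continuous inverse.\<close>
  have "?S ((?S ^^ k) x) = x" "(?S ^^ k) (?S x) = x" for x
    using Sp[of x] funpow_swap1[of ?S k x] unfolding k by (simp_all only: funpow.simps comp_apply)
  then have "homeomorphic_map ?Y ?Y ?S"
    unfolding homeomorphic_map_maps homeomorphic_maps_def
    using cont cont_a[of k] by blast
  moreover have "(?S ^^ a) x \<noteq> x" if a: "a \<in> {1..p - 1}" and x: "x \<in> topspace ?Y" for a x
  proof
    assume eq: "(?S ^^ a) x = x"
    obtain v where v: "0 < x v"
      using x unfolding topspace_realization_join
      by (metis (no_types, lifting) order_less_le sum.neutral zero_neq_one)
    have "0 < x ((shift p ^^ a) v)"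
      using v fun_cong[OF eq, of v] unfolding funpow_comp_right by simp
    with v x have "(shift p ^^ a) v = v"
      using funpow_shift_div[OF assms, of a v] unfolding topspace_realization_join by metis
    then have "(v mod p + a) mod p = v mod p"
      using funpow_shift_mod[OF assms] by metis
    then have "[v mod p + a = v mod p + 0] (mod p)"
      by (simp add: cong_def)
    then have "p dvd a"
      unfolding cong_add_lcancel_nat cong_0_iff .
    with a show False
      by (auto dest: dvd_imp_le)
  qed
  ultimately show ?thesis
    using Sp by (auto simp: free_Zp_space_def Zp_space_def)
qed

section \<open>Connectivity of the join\<close>

text \<open>A product of tent functions. It is positive exactly on the open unit cell with lower
  corner \<open>q\<close>, after the coordinates \<open>c i\<close> are scaled by \<open>m\<close>
  and translated by \<open>s\<close>.\<close>

definition bump :: "nat \<Rightarrow> (nat \<Rightarrow> 'z \<Rightarrow> real) \<Rightarrow> real \<Rightarrow> real \<Rightarrow> (nat \<Rightarrow> int) \<Rightarrow> 'z \<Rightarrow> real" where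
  "bump d c m s q z = (\<Prod>i<d. max 0 (1 / 2 - \<bar>m * c i z - s - of_int (q i) - 1 / 2\<bar>))"

lemma bump_nonneg: "0 \<le> bump d c m s q z"
  by (auto simp: bump_def intro: prod_nonneg)

lemma bump_pos_iff:
  "0 < bump d c m s q z \<longleftrightarrow> (\<forall>i<d. of_int (q i) < m * c i z - s \<and> m * c i z - s < of_int (q i) + 1)"
proof -
  have "0 < max 0 (1 / 2 - \<bar>m * c i z - s - of_int (q i) - 1 / 2\<bar>) \<longleftrightarrow>
      of_int (q i) < m * c i z - s \<and> m * c i z - s < of_int (q i) + 1" for i
    by (auto simp: max_def abs_if field_simps)
  moreover have "0 < bump d c m s q z \<longleftrightarrow>
      (\<forall>i\<in>{..<d}. 0 < max 0 (1 / 2 - \<bar>m * c i z - s - of_int (q i) - 1 / 2\<bar>))"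
    unfolding bump_def using bump_nonneg[of d c m s q z, unfolded bump_def]
    by (metis (no_types, lifting) finite_lessThan less_le max.cobounded1 prod_pos prod_zero_iff)
  ultimately show ?thesis
    by auto
qed

text \<open>Distinct open cells of one grid are disjoint, because integers less than
  \<open>1\<close> apart are equal.\<close>

lemma bump_unique:
  assumes "0 < bump d c m s q z" "0 < bump d c m s q' z"
    and "q \<in> {..<d} \<rightarrow>\<^sub>E A" "q' \<in> {..<d} \<rightarrow>\<^sub>E A"
  shows "q = q'"
proof (rule PiE_ext[OF assms(3,4)])
  fix i assume "i \<in> {..<d}"
  then have "of_int (q i) < of_int (q' i) + (1 :: real)" "of_int (q' i) < of_int (q i) + (1 :: real)"
    using assms(1,2) unfolding bump_pos_iff by (force)+
  then show "q i = q' i"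
    by linarith
qed

lemma bump_cell_diameter:
  assumes "0 < bump d c m s q x" "0 < bump d c m s q y" "i < d"
  shows "\<bar>m * c i x - m * c i y\<bar> < 1"
  using assms unfolding bump_pos_iff by (smt (verit))

lemma continuous_on_bump:
  assumes "\<And>i. i < d \<Longrightarrow> continuous_on Z (c i)"
  shows "continuous_on Z (bump d c m s q)"
  unfolding bump_def using assms by (intro continuous_intros) auto

text \<open>
  A coordinate meets the walls of at most one of the \<open>N\<close> translated grids, so \<open>d < N\<close>
  coordinates leave a grid for which the point is inside a cell.
\<close>

lemma bump_cover:
  assumes "d < N" and c: "\<And>i. i < d \<Longrightarrow> 0 \<le> c i z \<and> c i z \<le> 1"
  shows "\<exists>j<N. \<exists>q\<in>{..<d} \<rightarrow>\<^sub>E {-1..int m}. 0 < bump d c (real m) (real j / real N) q z"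
proof -
  define bad where "bad i = {j. j < N \<and> real m * c i z - real j / real N \<in> \<int>}" for i
  have bad_unique: "j = j'" if "j \<in> bad i" "j' \<in> bad i" for i j j'
  proof -
    have "(real m * c i z - real j / real N) - (real m * c i z - real j' / real N) \<in> \<int>"
      using that unfolding bad_def by (intro Ints_diff[of "real m * c i z - real j / real N"]) auto
    then obtain k where k: "(real j' - real j) / real N = of_int k"
      by (auto simp: Ints_def diff_divide_distrib)
    have lt: "\<bar>(real j' - real j) / real N\<bar> < 1"
      using that by (auto simp: bad_def abs_if field_simps)
    then have "k = 0"
      unfolding k by linarith
    then show ?thesis
      using k assms(1) by auto
  qed
  have "card (bad i) \<le> 1" for i
  proof -
    have "finite (bad i)"
      by (rule finite_subset[of _ "{..<N}"]) (auto simp: bad_def)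
    then show ?thesis
      using bad_unique[of _ i] unfolding One_nat_def by (subst card_le_Suc0_iff_eq) blast+
  qed
  then have "card (\<Union>i<d. bad i) \<le> d"
    using card_UN_le[of "{..<d}" bad] sum_bounded_above[of "{..<d}" "\<lambda>i. card (bad i)" 1]
    by (simp add: order.trans)
  then have "\<not> {..<N} \<subseteq> (\<Union>i<d. bad i)"
    using assms(1) card_mono[of "\<Union>i<d. bad i" "{..<N}"] by (auto simp: bad_def)
  then obtain j where j: "j < N" "\<And>i. i < d \<Longrightarrow> j \<notin> bad i"
    by blast
  define t where "t i = real m * c i z - real j / real N" for i
  define q where "q = (\<lambda>i\<in>{..<d}. \<lfloor>t i\<rfloor>)"
  have "0 < bump d c (real m) (real j / real N) q z"
    unfolding bump_pos_iff
  proof (intro allI impI)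
    fix i assume i: "i < d"
    have "t i \<notin> \<int>"
      using j i by (auto simp: bad_def t_def)
    then have "of_int \<lfloor>t i\<rfloor> < t i"
      by (metis Ints_of_int floor_correct order_le_less)
    then show "of_int (q i) < real m * c i z - real j / real N \<and>
        real m * c i z - real j / real N < of_int (q i) + 1"
      using i by (simp add: q_def t_def[symmetric])
  qed
  moreover have "q \<in> {..<d} \<rightarrow>\<^sub>E {-1..int m}"
  proof (rule PiE_I)
    fix i assume i: "i \<in> {..<d}"
    have "0 \<le> real m * c i z" "real m * c i z \<le> real m"
      using c[of i] i by (auto intro: mult_left_le)
    moreover have "0 \<le> real j / real N" "real j / real N < 1"
      using j by auto
    \<comment> \<open>The translation is by less than one unit, so corners from \<open>-1\<close> on
      suffice.\<close>
    ultimately have "-1 \<le> t i" "t i \<le> real m"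
      unfolding t_def by linarith+
    then show "q i \<in> {-1..int m}"
      using i by (auto simp: q_def le_floor_iff floor_le_iff)
  qed (simp add: q_def)
  ultimately show ?thesis
    using j by blast
qed

text \<open>The pairs on which \<open>h\<close> differs by at least \<open>e\<close> form a compact
  set. The coordinates separate points, so the sum of their absolute differences has a lower bound
  \<open>r > 0\<close> on it, and once \<open>m > d / r\<close> no such pair fits into one
  cell.\<close>

lemma eventually_cells_small:
  fixes Z :: "'z::metric_space set" and c :: "nat \<Rightarrow> 'z \<Rightarrow> real" and h :: "'z \<Rightarrow> real"
  assumes "compact Z" and c: "\<And>i. i < d \<Longrightarrow> continuous_on Z (c i)"
    and inj: "\<And>x y. \<lbrakk>x \<in> Z; y \<in> Z; \<And>i. i < d \<Longrightarrow> c i x = c i y\<rbrakk> \<Longrightarrow> x = y"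
    and h: "continuous_on Z h" and "0 < e"
  shows "\<forall>\<^sub>F m in sequentially. \<forall>x\<in>Z. \<forall>y\<in>Z.
    (\<forall>i<d. \<bar>real m * c i x - real m * c i y\<bar> < 1) \<longrightarrow> \<bar>h x - h y\<bar> < e"
proof -
  define K where "K = (Z \<times> Z) \<inter> (\<lambda>w. \<bar>h (fst w) - h (snd w)\<bar>) -` {e..}"
  define g where "g w = (\<Sum>i<d. \<bar>c i (fst w) - c i (snd w)\<bar>)" for w
  have comp: "continuous_on (Z \<times> Z) (\<lambda>w. f (fst w))" "continuous_on (Z \<times> Z) (\<lambda>w. f (snd w))"
    if "continuous_on Z f" for f :: "'z \<Rightarrow> real"
    using that by (auto intro!: continuous_on_compose2[of Z f] continuous_intros)
  have "closedin (top_of_set (Z \<times> Z)) K"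
    unfolding K_def using comp[OF h]
    by (intro continuous_closedin_preimage continuous_intros) auto
  then have K: "compact K"
    using closedin_compact compact_Times assms(1) by blast
  have g: "continuous_on K g"
    unfolding g_def
    by (rule continuous_on_subset[of "Z \<times> Z"]) (use comp[OF c] in \<open>auto simp: K_def intro!: continuous_intros\<close>)
  obtain r where r: "0 < r" "\<And>w. w \<in> K \<Longrightarrow> r \<le> g w"
  proof (cases "K = {}")
    case False
    then obtain w0 where w0: "w0 \<in> K" "\<And>w. w \<in> K \<Longrightarrow> g w0 \<le> g w"
      using continuous_attains_inf[OF K _ g] by blast
    then have "fst w0 \<in> Z" "snd w0 \<in> Z" "fst w0 \<noteq> snd w0"
      using \<open>0 < e\<close> by (auto simp: K_def)
    then obtain i where "i < d" "c i (fst w0) \<noteq> c i (snd w0)"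
      using inj by blast
    then have "0 < g w0"
      unfolding g_def by (intro sum_pos2[of _ i]) auto
    then show ?thesis
      using w0 that by blast
  qed (use that[of 1] in auto)
  obtain M where M: "real d / r < real M"
    using reals_Archimedean2 by blast
  have "\<bar>h x - h y\<bar> < e" if m: "M \<le> m" and xy: "x \<in> Z" "y \<in> Z"
    and small: "\<forall>i<d. \<bar>real m * c i x - real m * c i y\<bar> < 1" for m x y
  proof (rule ccontr)
    assume "\<not> \<bar>h x - h y\<bar> < e"
    then have "(x, y) \<in> K"
      using xy by (auto simp: K_def)
    then have "real m * r \<le> real m * g (x, y)"
      using r by (intro mult_left_mono) auto
    also have "\<dots> = (\<Sum>i<d. \<bar>real m * c i x - real m * c i y\<bar>)"
      by (simp add: g_def sum_distrib_left abs_mult flip: right_diff_distrib)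
    also have "\<dots> \<le> real d"
      using sum_bounded_above[of "{..<d}" "\<lambda>i. \<bar>real m * c i x - real m * c i y\<bar>" 1] small by force
    finally have "real m \<le> real d / r"
      using r by (simp add: field_simps)
    then show False
      using M m by linarith
  qed
  then show ?thesis
    unfolding eventually_sequentially by blast
qed

text \<open>
  \<open>H\<close> takes values in the \<open>N\<close>-th power of the cone over \<open>p\<close> points, and its zeros are removed
  without changing it where it lies in the join. Where \<open>H\<close> is small, coordinates up to \<open>e\<close>
  are truncated to \<open>0\<close>, so that on a small cell row \<open>j\<close> has at most one nonzero
  column, and a bump in that column is added on every cell of the \<open>j\<close>-th grid.
\<close>

lemma perturb_to_nonzero:
  fixes Z :: "'z::metric_space set" and c H :: "nat \<Rightarrow> 'z \<Rightarrow> real"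
  assumes "compact Z" "0 < p" "d < N"
    and c_cont: "\<And>i. i < d \<Longrightarrow> continuous_on Z (c i)"
    and c_range: "\<And>i z. i < d \<Longrightarrow> z \<in> Z \<Longrightarrow> 0 \<le> c i z \<and> c i z \<le> 1"
    and c_inj: "\<And>x y. \<lbrakk>x \<in> Z; y \<in> Z; \<And>i. i < d \<Longrightarrow> c i x = c i y\<rbrakk> \<Longrightarrow> x = y"
    and H_cont: "\<And>v. v < N * p \<Longrightarrow> continuous_on Z (H v)"
    and H_nonneg: "\<And>v z. v < N * p \<Longrightarrow> z \<in> Z \<Longrightarrow> 0 \<le> H v z"
    and H_disj: "\<And>v w z. \<lbrakk>v < N * p; w < N * p; z \<in> Z; 0 < H v z; 0 < H w z; v div p = w div p\<rbrakk>
      \<Longrightarrow> v = w"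
  obtains G :: "nat \<Rightarrow> 'z \<Rightarrow> real"
  where "\<And>v. v < N * p \<Longrightarrow> continuous_on Z (G v)"
    and "\<And>v z. 0 \<le> G v z"
    and "\<And>z. z \<in> Z \<Longrightarrow> \<exists>v<N * p. 0 < G v z"
    and "\<And>v w z. \<lbrakk>v < N * p; w < N * p; z \<in> Z; 0 < G v z; 0 < G w z; v div p = w div p\<rbrakk> \<Longrightarrow> v = w"
    and "\<And>v z. \<lbrakk>v < N * p; z \<in> Z; (\<Sum>w<N * p. H w z) = 1\<rbrakk> \<Longrightarrow> G v z = H v z"
proof -
  define n where "n = N * p"
  have n: "0 < n"
    using assms(2,3) by (simp add: n_def)
  have row_less: "v < n" if "v div p < N" for v
    using that assms(2) by (simp add: n_def div_less_iff_less_mult)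
  \<comment> \<open>If all \<open>n\<close> values \<open>H w z\<close> are at most
    \<open>e\<close>, their sum is at most \<open>1 / 4\<close>. So where the sum is at least
    \<open>1 / 2\<close>, some value survives the truncation.\<close>
  define e where "e = 1 / (4 * real n)"
  have e: "0 < e"
    using n by (simp add: e_def)
  have "\<forall>\<^sub>F m in sequentially. \<forall>v\<in>{..<n}. \<forall>x\<in>Z. \<forall>y\<in>Z.
    (\<forall>i<d. \<bar>real m * c i x - real m * c i y\<bar> < 1) \<longrightarrow> \<bar>H v x - H v y\<bar> < e"
  proof (rule eventually_ball_finite, simp, rule ballI)
    fix v assume v: "v \<in> {..<n}"
    have "continuous_on Z (H v)"
      using H_cont v by (simp add: n_def)
    from eventually_cells_small[OF \<open>compact Z\<close> c_cont c_inj this e]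
    show "\<forall>\<^sub>F m in sequentially. \<forall>x\<in>Z. \<forall>y\<in>Z.
        (\<forall>i<d. \<bar>real m * c i x - real m * c i y\<bar> < 1) \<longrightarrow> \<bar>H v x - H v y\<bar> < e" .
  qed
  then obtain m where "\<forall>v\<in>{..<n}. \<forall>x\<in>Z. \<forall>y\<in>Z.
      (\<forall>i<d. \<bar>real m * c i x - real m * c i y\<bar> < 1) \<longrightarrow> \<bar>H v x - H v y\<bar> < e"
    unfolding eventually_sequentially by blast
  then have m: "\<lbrakk>v < n; x \<in> Z; y \<in> Z;
      \<And>i. i < d \<Longrightarrow> \<bar>real m * c i x - real m * c i y\<bar> < 1\<rbrakk> \<Longrightarrow> \<bar>H v x - H v y\<bar> < e" for v x y
    by blast
  define Q where "Q = ({..<d} \<rightarrow>\<^sub>E {-1..int m})"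
  define b where "b j q = bump d c (real m) (real j / real N) q" for j q
  have finQ: "finite Q"
    by (simp add: Q_def finite_PiE)
  \<comment> \<open>\<open>H v\<close> varies by less than \<open>e\<close> over a cell, so a column
    that exceeds \<open>e\<close> somewhere is positive on the whole cell and can be compared with
    another one at the same point.\<close>
  have same_leg: "v = w" if "v < n" "w < n" "v div p = w div p" "x \<in> Z" "y \<in> Z" "0 < b j q x" "0 < b j q y"
    "e < H v x" "e < H w y" for v w x y j q
  proof -
    have "\<bar>H v x - H v y\<bar> < e"
      by (rule m) (use that bump_cell_diameter in \<open>auto simp: b_def\<close>)
    then have "0 < H v y" "0 < H w y"
      using that e by linarith+
    then show ?thesis
      using H_disj[of v w y] that by (simp add: n_def)
  qed
  \<comment> \<open>Such a column becomes the label \<open>lab j q\<close> of the cell. If nothing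
    in row \<open>j\<close> exceeds \<open>e\<close> on the cell, any column of the row would do,
    and column \<open>0\<close>, which is \<open>j * p\<close>, serves as witness.\<close>
  have "\<exists>v. v div p = j \<and> (\<forall>x\<in>Z. \<forall>w<n. 0 < b j q x \<and> e < H w x \<and> w div p = j \<longrightarrow> w = v)" for j q
  proof (cases "\<exists>x\<in>Z. \<exists>w<n. 0 < b j q x \<and> e < H w x \<and> w div p = j")
    case True
    then show ?thesis
      using same_leg by metis
  next
    case False
    then have "j * p div p = j \<and> (\<forall>x\<in>Z. \<forall>w<n. 0 < b j q x \<and> e < H w x \<and> w div p = j \<longrightarrow> w = j * p)"
      using assms(2) by auto
    then show ?thesis
      by blast
  qed
  then obtain lab where lab: "\<And>j q. lab j q div p = j"
    "\<And>j q x w. \<lbrakk>x \<in> Z; w < n; 0 < b j q x; e < H w x; w div p = j\<rbrakk> \<Longrightarrow> w = lab j q"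
    by metis
  define s where "s z = (\<Sum>w<n. H w z)" for z
  \<comment> \<open>The bumps are only switched on where the truncation already has its full size \<open>e\<close>.\<close>
  define t where "t z = e * min 1 (2 * max 0 (1 - s z))" for z
  define u where "u z = max 0 (1 / 2 - s z)" for z
  define B where "B v z = (\<Sum>q | q \<in> Q \<and> lab (v div p) q = v. b (v div p) q z)" for v z
  define G where "G v z = max 0 (H v z - t z) + u z * B v z" for v z
  have B_nonneg: "0 \<le> B v z" for v z
    unfolding B_def b_def by (intro sum_nonneg bump_nonneg)
  have B_pos: "\<exists>q\<in>Q. lab (v div p) q = v \<and> 0 < b (v div p) q z" if "0 < B v z" for v z
  proof (rule ccontr)
    assume "\<not> ?thesis"
    then have "B v z \<le> 0"
      unfolding B_def by (intro sum_nonpos) (auto simp: not_less)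
    with that show False
      by simp
  qed
  have t_nonneg: "0 \<le> t z" and t_le: "t z \<le> e" and u_nonneg: "0 \<le> u z" for z
    using e by (auto simp: t_def u_def)
  show thesis
  proof (rule that[of G])
    fix v assume v: "v < N * p"
    have s_cont: "continuous_on Z s"
      unfolding s_def using H_cont by (intro continuous_intros) (simp add: n_def)
    then show "continuous_on Z (G v)"
      unfolding G_def t_def u_def B_def b_def
      using H_cont[OF v] c_cont by (intro continuous_intros continuous_on_bump) auto
  next
    show "0 \<le> G v z" for v z
      using B_nonneg u_nonneg by (simp add: G_def)
  next
    fix z assume z: "z \<in> Z"
    show "\<exists>v<N * p. 0 < G v z"
    proof (cases "s z < 1 / 2")
      case True
      obtain j q where jq: "j < N" "q \<in> Q" "0 < b j q z"
        using bump_cover[OF \<open>d < N\<close>, of c z m] c_range z unfolding b_def Q_def by blast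
      define v where "v = lab j q"
      have v: "v div p = j"
        by (simp add: v_def lab)
      have "0 < B v z"
        unfolding B_def v using jq finQ bump_nonneg
        by (intro sum_pos2[of _ q]) (auto simp: v_def b_def)
      then have "0 < u z * B v z"
        using True by (simp add: u_def)
      then have "0 < G v z"
        unfolding G_def by linarith
      moreover have "v < N * p"
        using row_less[of v] jq v by (simp add: n_def)
      ultimately show ?thesis
        by blast
    next
      case False
      have "\<exists>v<n. e < H v z"
      proof (rule ccontr)
        assume "\<not> ?thesis"
        then have "H w z \<le> e" if "w < n" for w
          using that not_less by blast
        then have "s z \<le> real n * e"
          unfolding s_def using sum_bounded_above[of "{..<n}" "\<lambda>w. H w z" e] by simp
        with False n show False
          by (simp add: e_def)
      qed
      then obtain v where v: "v < n" "e < H v z"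
        by blast
      then have "0 < max 0 (H v z - t z)"
        using t_le[of z] by linarith
      then have "0 < G v z"
        using B_nonneg[of v z] u_nonneg[of z] by (simp add: G_def add_pos_nonneg)
      then show ?thesis
        using v by (auto simp: n_def)
    qed
  next
    fix v w z
    assume vw: "v < N * p" "w < N * p" and z: "z \<in> Z" and G: "0 < G v z" "0 < G w z"
      and row: "v div p = w div p"
    have cases: "t z < H x z \<or> 0 < u z \<and> (\<exists>q\<in>Q. lab (x div p) q = x \<and> 0 < b (x div p) q z)"
      if "0 < G x z" for x
    proof (rule ccontr)
      assume not: "\<not> ?thesis"
      then have "u z * B x z = 0"
        using B_pos[of x z] B_nonneg[of x z] u_nonneg[of z] by (metis mult_eq_0_iff order_le_less)
      moreover have "max 0 (H x z - t z) = 0"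
        using not by auto
      ultimately show False
        using that unfolding G_def by linarith
    qed
    have t_eq: "t z = e" if "0 < u z"
      using that by (auto simp: t_def u_def)
    \<comment> \<open>Where bumps are switched on, a value that survives the truncation exceeds
      \<open>e\<close>, so the label of the cell names its column.\<close>
    have mixed: "x = y" if "t z < H x z" "0 < u z" "q \<in> Q" "lab (y div p) q = y" "0 < b (y div p) q z"
      "x < n" "x div p = y div p" for x y q
    proof -
      have "e < H x z"
        using that(1) t_eq[OF that(2)] by simp
      from lab(2)[OF z that(6,5) this that(7)] show ?thesis
        unfolding that(4) .
    qed
    from cases[OF G(1)] cases[OF G(2)] show "v = w"
    proof (elim disjE conjE bexE)
      assume "t z < H v z" "t z < H w z"
      then have "0 < H v z" "0 < H w z"
        using t_nonneg[of z] by linarith+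
      then show ?thesis
        by (rule H_disj[OF vw z _ _ row])
    next
      fix q assume "t z < H v z" "0 < u z" "q \<in> Q" "lab (w div p) q = w" "0 < b (w div p) q z"
      from mixed[OF this vw(1)[folded n_def] row] show ?thesis .
    next
      fix q assume "t z < H w z" "0 < u z" "q \<in> Q" "lab (v div p) q = v" "0 < b (v div p) q z"
      from mixed[OF this vw(2)[folded n_def] row[symmetric]] show ?thesis ..
    next
      \<comment> \<open>Two bumps in one row come from the same grid, hence from the same cell with
        one label.\<close>
      fix q q' assume q: "q \<in> Q" "lab (v div p) q = v" "0 < b (v div p) q z"
        "q' \<in> Q" "lab (w div p) q' = w" "0 < b (w div p) q' z"
      have "q = q'"
        by (rule bump_unique[OF q(3)[unfolded row b_def] q(6)[unfolded b_def]
              q(1)[unfolded Q_def] q(4)[unfolded Q_def]])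
      from q(2)[unfolded row this] q(5) show ?thesis
        by (rule trans[OF sym])
    qed
  next
    fix v z assume v: "v < N * p" and z: "z \<in> Z" and "(\<Sum>w<N * p. H w z) = 1"
    then have "t z = 0" "u z = 0"
      by (simp_all add: t_def u_def s_def n_def)
    then show "G v z = H v z"
      using H_nonneg[OF v z] by (simp add: G_def)
  qed
qed

section \<open>Null homotopies of maps on cubes\<close>

lemma cube_eq: "cube k = top_of_set (cube_set k)"
proof -
  have "{x. \<forall>i\<ge>k. x i = 0} \<inter> cube_set k = cube_set k"
    by (auto simp: cube_set_def topspace_Euclidean_space)
  then show ?thesis
    by (simp add: cube_def Euclidean_space_def subtopology_subtopology euclidean_product_topology)
qed

lemma compact_cube_set: "compact (cube_set k)"
proof -
  have "cube_set k = (\<Pi>\<^sub>E i\<in>UNIV. if i < k then {0..1} else {0})"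
    by (auto simp: cube_set_def topspace_Euclidean_space PiE_iff split: if_splits)
  then have "compactin (powertop_real UNIV) (cube_set k)"
    by (simp add: compactin_PiE)
  then show ?thesis
    by (simp add: euclidean_product_topology)
qed

lemma prod_topology_top_of_set:
  "prod_topology (top_of_set A) (top_of_set B) = top_of_set (A \<times> B)"
  by (simp add: prod_topology_subtopology subtopology_subtopology Times_Int_Times)

text \<open>
  A null homotopy first exists with values in the product of the cones over the rows: in
  each row, move along the tree from the value of \<open>f\<close> to that of \<open>b\<close>. It may pass
  through the common apex, and \<open>perturb_to_nonzero\<close> removes these zeros.
\<close>

lemma homotopy_group_vanishes_join:
  assumes "0 < p" "k + 1 < N" and b: "b \<in> topspace (realization (join_complex p N))"
  shows "homotopy_group_vanishes k (realization (join_complex p N)) b"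
  unfolding homotopy_group_vanishes_def
proof (intro allI impI, elim conjE)
  let ?Y = "realization (join_complex p N)"
  fix f assume f: "continuous_map (cube k) ?Y f" and fb: "f ` cube_boundary k \<subseteq> {b}"
  define Z where "Z = {0..1::real} \<times> cube_set k"
  \<comment> \<open>Time is the last coordinate, with index \<open>k\<close>, so the parameter space
    has \<open>k + 1 < N\<close> coordinates.\<close>
  define c where "c i z = (if i < k then snd z i else fst z)" for i and z :: "real \<times> (nat \<Rightarrow> real)"
  \<comment> \<open>Up to time \<open>1 / 2\<close> the coordinate falls from its value in
    \<open>f\<close> to the minimum with \<open>b\<close>, and afterwards it rises to its value in
    \<open>b\<close>. The minimum marks the point where the two branches of the tree part, so the
    path is constant where \<open>f\<close> and \<open>b\<close> agree.\<close>
  define H where "H v z = max (max (f (snd z) v - 2 * fst z) (min (f (snd z) v) (b v)))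
    (b v - 2 * (1 - fst z))" for v and z :: "real \<times> (nat \<Rightarrow> real)"
  have f_in: "f x \<in> topspace ?Y" if "x \<in> cube_set k" for x
    using f that by (auto simp: cube_eq continuous_map_def)
  have nonneg: "0 \<le> y v" and zero: "N * p \<le> v \<Longrightarrow> y v = 0" and sum1: "(\<Sum>v<N * p. y v) = 1"
    and row: "0 < y v \<Longrightarrow> 0 < y w \<Longrightarrow> v div p = w div p \<Longrightarrow> v = w"
    if "y \<in> topspace ?Y" for y v w
    using that unfolding topspace_realization_join by blast+
  have le1: "y v \<le> 1" if y: "y \<in> topspace ?Y" for y v
  proof (cases "v < N * p")
    case True
    then show ?thesis
      using member_le_sum[of v "{..<N * p}" y] nonneg[OF y] sum1[OF y] by simp
  qed (use zero[OF y] in simp)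
  have f_cont: "continuous_on (cube_set k) (\<lambda>x. f x v)" for v
    using f unfolding cube_eq realization_def continuous_map_in_subtopology
      continuous_map_componentwise_UNIV by simp
  have compact: "compact Z"
    unfolding Z_def by (intro compact_Times compact_cube_set) simp
  have c_cont: "continuous_on Z (c i)" if "i < k + 1" for i
  proof (cases "i < k")
    case True
    have "continuous_on Z snd"
      by (intro continuous_intros)
    from continuous_on_product_then_coordinatewise[OF this, of i] show ?thesis
      using True by (simp add: c_def)
  next
    case False
    then show ?thesis
      unfolding c_def by (simp add: continuous_on_fst)
  qed
  have Z: "0 \<le> fst z" "fst z \<le> 1" "snd z \<in> cube_set k" if "z \<in> Z" for z
    using that by (auto simp: Z_def mem_Times_iff)
  have cube: "i < k \<Longrightarrow> 0 \<le> x i \<and> x i \<le> 1" "k \<le> i \<Longrightarrow> x i = 0" if "x \<in> cube_set k" for x i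
    using that by (simp_all add: cube_set_def topspace_Euclidean_space)
  have c_range: "0 \<le> c i z \<and> c i z \<le> 1" if "i < k + 1" "z \<in> Z" for i z
    using Z[OF that(2)] cube(1)[OF Z(3)[OF that(2)], of i] by (simp add: c_def)
  have c_inj: "x = y" if x: "x \<in> Z" and y: "y \<in> Z" and eq: "\<And>i. i < k + 1 \<Longrightarrow> c i x = c i y" for x y
  proof (rule prod_eqI)
    show "fst x = fst y"
      using eq[of k] by (simp add: c_def)
    show "snd x = snd y"
    proof
      fix i show "snd x i = snd y i"
        using eq[of i] cube(2)[OF Z(3)[OF x], of i] cube(2)[OF Z(3)[OF y], of i]
        by (cases "i < k") (simp_all add: c_def)
    qed
  qed
  have H_cont: "continuous_on Z (H v)" if "v < N * p" for v
  proof -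
    have "continuous_on Z (\<lambda>z. f (snd z) v)"
      by (rule continuous_on_compose2[OF f_cont continuous_on_snd[OF continuous_on_id]]) (use Z(3) in auto)
    then show ?thesis
      unfolding H_def by (intro continuous_intros)
  qed
  have H_nonneg: "0 \<le> H v z" if "v < N * p" "z \<in> Z" for v z
    using nonneg[OF b, of v] nonneg[OF f_in[OF Z(3)[OF that(2)]], of v] by (simp add: H_def)
  have H_disj: "v = w" if "v < N * p" "w < N * p" and z: "z \<in> Z" and H: "0 < H v z" "0 < H w z"
    and vw: "v div p = w div p" for v w z
  proof -
    note t = Z(1,2)[OF z] and x = f_in[OF Z(3)[OF z]]
    have cases: "2 * fst z < f (snd z) u \<or> 0 < f (snd z) u \<and> 0 < b u \<or> 2 * (1 - fst z) < b u"
      if "0 < H u z" for u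
      using that by (auto simp: H_def less_max_iff_disj)
    \<comment> \<open>A coordinate above the minimum on the side of \<open>f\<close> needs a time
      below \<open>1 / 2\<close>, and on the side of \<open>b\<close> a time above
      \<open>1 / 2\<close>. So two positive coordinates are both positive in \<open>f\<close> or
      both positive in \<open>b\<close>.\<close>
    have "0 < f (snd z) v \<and> 0 < f (snd z) w \<or> 0 < b v \<and> 0 < b w"
      using cases[OF H(1)] cases[OF H(2)] t le1[OF x, of v] le1[OF x, of w] le1[OF b, of v] le1[OF b, of w]
      by argo
    then show ?thesis
      using row[OF x _ _ vw] row[OF b _ _ vw] by blast
  qed
  obtain G where G_cont: "\<And>v. v < N * p \<Longrightarrow> continuous_on Z (G v)"
    and G_nonneg: "\<And>v z. 0 \<le> G v z"
    and G_pos: "\<And>z. z \<in> Z \<Longrightarrow> \<exists>v<N * p. 0 < G v z"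
    and G_disj: "\<And>v w z. \<lbrakk>v < N * p; w < N * p; z \<in> Z; 0 < G v z; 0 < G w z; v div p = w div p\<rbrakk> \<Longrightarrow> v = w"
    and G_eq: "\<And>v z. \<lbrakk>v < N * p; z \<in> Z; (\<Sum>w<N * p. H w z) = 1\<rbrakk> \<Longrightarrow> G v z = H v z"
  proof -
    show thesis
      by (rule perturb_to_nonzero[OF compact assms(1,2), where c = c and H = H])
        (fact c_cont c_range c_inj H_cont H_nonneg H_disj that)+
  qed
  define h where "h z v = (if v < N * p then G v z / (\<Sum>w<N * p. G w z) else 0)" for z v
  have h_cont: "continuous_map (top_of_set Z) ?Y h"
    unfolding h_def by (rule continuous_map_normalize) (use G_cont G_nonneg G_pos G_disj in auto)
  \<comment> \<open>Where \<open>H\<close> is already in the join, neither the perturbation nor the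
    normalization changes it. This settles both ends of the homotopy and the boundary of the
    cube.\<close>
  have h_eq: "h z = y" if z: "z \<in> Z" and y: "y \<in> topspace ?Y" and eq: "\<And>v. H v z = y v" for z y
  proof
    fix v
    have G: "G w z = y w" if "w < N * p" for w
      using G_eq[OF that z] sum1[OF y] by (simp add: eq)
    have "(\<Sum>w<N * p. G w z) = (\<Sum>w<N * p. y w)"
      by (rule sum.cong) (simp_all add: G)
    then have "(\<Sum>w<N * p. G w z) = 1"
      using sum1[OF y] by simp
    then show "h z v = y v"
      using G zero[OF y, of v] by (simp add: h_def)
  qed
  have ends: "h (0, x) = f x \<and> h (1, x) = b" if x: "x \<in> cube_set k" for x
  proof -
    have "(0, x) \<in> Z" "(1, x) \<in> Z"
      using x by (simp_all add: Z_def)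
    moreover have "H v (0, x) = f x v" "H v (1, x) = b v" for v
      using le1[OF b, of v] le1[OF f_in[OF x], of v] nonneg[OF b, of v] nonneg[OF f_in[OF x], of v]
      by (simp_all add: H_def)
    ultimately show ?thesis
      using h_eq f_in[OF x] b by blast
  qed
  have stay: "h (t, x) = b" if "t \<in> {0..1}" "x \<in> cube_boundary k" for t x
  proof (rule h_eq[OF _ b])
    have "f x = b"
      using that fb by auto
    then show "H v (t, x) = b v" for v
      using that(1) by (simp add: H_def)
    show "(t, x) \<in> Z"
      using that by (auto simp: Z_def cube_boundary_def)
  qed
  show "homotopic_with (\<lambda>g. g ` cube_boundary k \<subseteq> {b}) (cube k) ?Y f (\<lambda>_. b)"
  proof (subst homotopic_with)
    show "\<exists>h. continuous_map (prod_topology (top_of_set {0..1::real}) (cube k)) ?Y h \<and>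
        (\<forall>x\<in>topspace (cube k). h (0, x) = f x) \<and> (\<forall>x\<in>topspace (cube k). h (1, x) = b) \<and>
        (\<forall>t\<in>{0..1}. (\<lambda>x. h (t, x)) ` cube_boundary k \<subseteq> {b})"
    proof (intro exI[of _ h] conjI ballI)
      show "continuous_map (prod_topology (top_of_set {0..1}) (cube k)) ?Y h"
        using h_cont by (simp add: cube_eq prod_topology_top_of_set Z_def)
    qed (use ends stay in \<open>auto simp: cube_eq\<close>)
  next
    fix g g' :: "(nat \<Rightarrow> real) \<Rightarrow> nat \<Rightarrow> real"
    assume "\<And>x. x \<in> topspace (cube k) \<Longrightarrow> g x = g' x"
    then have "g x = g' x" if "x \<in> cube_boundary k" for x
      using that by (simp add: cube_eq cube_boundary_def)
    then show "g ` cube_boundary k \<subseteq> {b} \<longleftrightarrow> g' ` cube_boundary k \<subseteq> {b}"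
      by (simp add: image_subset_iff)
  qed
qed

lemma EnZp_space_join:
  assumes "0 < p" "0 < N"
  shows "EnZp_space (N - 1) p (join_complex p N) (\<lambda>x. x \<circ> shift p)"
proof -
  have "(\<lambda>v. if v = 0 then 1 else 0) \<in> topspace (realization (join_complex p N))"
    using assms by (simp add: topspace_realization_join)
  then have "connected_below (N - 1) (realization (join_complex p N))"
    using homotopy_group_vanishes_join[OF assms(1)] by (auto simp: connected_below_def)
  then show ?thesis
    using assms finite_complex_join has_dimension_join simplicial_self_map_shift free_Zp_space_join
    by (simp add: EnZp_space_def)
qed

section \<open>Mapping periodic points to the join\<close>

text \<open>The distance to \<open>a\<close> separates \<open>x\<close> from \<open>T x\<close> for
  all \<open>x\<close> in an open set that contains \<open>a\<close> itself, because
  \<open>T a \<noteq> a\<close>. Finitely many of these sets cover the compact space.\<close>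

lemma separating_functions:
  assumes "dynamical_system X T" and "fixed_point_free X T"
  obtains M :: nat and f :: "nat \<Rightarrow> 'a \<Rightarrow> real"
  where "\<And>i. i < M \<Longrightarrow> continuous_map X euclideanreal (f i)"
    and "\<And>x. x \<in> topspace X \<Longrightarrow> \<exists>i<M. f i x \<noteq> f i (T x)"
proof -
  have "compact_space X" "metrizable_space X" and T: "continuous_map X X T"
    using assms(1) by (auto simp: dynamical_system_def homeomorphic_imp_continuous_map)
  then obtain m where X: "X = mtopology_of m"
    by (metis Metric_space.mtopology_of metrizable_space_def)
  have dist_cont: "continuous_map X euclideanreal (mdist m a)" if "a \<in> topspace X" for a
    using continuous_on_mdist[of a m] that by (simp add: X)
  define U where "U a = {x \<in> topspace X. mdist m a x - mdist m a (T x) \<in> - {0}}" for a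
  have "openin X (U a)" if "a \<in> topspace X" for a
  proof -
    have "continuous_map X euclideanreal (\<lambda>x. mdist m a x - mdist m a (T x))"
      using dist_cont[OF that] continuous_map_compose[OF T dist_cont[OF that]]
      by (intro continuous_map_diff) (simp_all add: comp_def)
    then show ?thesis
      unfolding U_def by (rule openin_continuous_map_preimage) (simp add: open_Compl flip: open_openin)
  qed
  moreover have in_U: "x \<in> U x" if "x \<in> topspace X" for x
  proof -
    have "T x \<in> topspace X" "T x \<noteq> x"
      using that assms(2) T
      by (auto simp: fixed_point_free_def periodic_points_def continuous_map_def)
    then show ?thesis
      using that Metric_space.zero[OF Metric_space_mspace_mdist[of m]]
      unfolding U_def X topspace_mtopology_of by (simp, metis)
  qed
  ultimately obtain \<F> where "finite \<F>" "\<F> \<subseteq> U ` topspace X" "topspace X \<subseteq> \<Union>\<F>"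
    using compactinD[of X "topspace X" "U ` topspace X"] \<open>compact_space X\<close>
    unfolding compact_space_def by blast
  then obtain A where A: "finite A" "A \<subseteq> topspace X" "topspace X \<subseteq> \<Union>(U ` A)"
    by (metis finite_subset_image)
  obtain M :: nat and e where e: "A = e ` {i. i < M}"
    using finite_imp_nat_seg_image_inj_on[OF A(1)] by blast
  show thesis
  proof (rule that[of M "\<lambda>i. mdist m (e i)"])
    show "continuous_map X euclideanreal (mdist m (e i))" if "i < M" for i
      using dist_cont A(2) that by (auto simp: e)
    show "\<exists>i<M. mdist m (e i) x \<noteq> mdist m (e i) (T x)" if "x \<in> topspace X" for x
      using A(3) that by (fastforce simp: e U_def)
  qed
qed

section \<open>Positions of the largest values\<close>

text \<open>For \<open>S\<close> inside \<open>{..<p}\<close>, a continuous test of whether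
  \<open>t\<close> is larger on \<open>S\<close> than off it. For the empty and the full set it is
  an empty product with value \<open>1\<close>, so only sizes strictly between \<open>0\<close> and
  \<open>p\<close> carry information.\<close>

definition gap :: "nat \<Rightarrow> (nat \<Rightarrow> real) \<Rightarrow> nat set \<Rightarrow> real" where
  "gap p t S = (\<Prod>b\<in>S. \<Prod>c\<in>{..<p} - S. max 0 (t b - t c))"

text \<open>
  Adding \<open>1\<close> modulo \<open>p\<close> to the elements of a set of size \<open>k\<close> adds \<open>k\<close> to their sum, which is
  invertible modulo \<open>p\<close> for \<open>0 < k < p\<close>. So \<open>a\<close> is an equivariant label of these sets.
\<close>

definition residue_subsets :: "nat \<Rightarrow> nat \<Rightarrow> nat \<Rightarrow> nat set set" where
  "residue_subsets p k a = {S \<in> Pow {..<p}. card S = k \<and> [\<Sum>S = k * a] (mod p)}"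

lemma finite_residue_subsets: "finite (residue_subsets p k a)"
  by (simp add: residue_subsets_def)

lemma gap_nonneg: "0 \<le> gap p t S"
  unfolding gap_def by (intro prod_nonneg) simp

lemma gap_posI:
  assumes "\<And>b c. b \<in> S \<Longrightarrow> c < p \<Longrightarrow> c \<notin> S \<Longrightarrow> t c < t b"
  shows "0 < gap p t S"
  unfolding gap_def using assms by (intro prod_pos ballI) auto

lemma gap_posD:
  assumes "0 < gap p t S" "S \<subseteq> {..<p}" "b \<in> S" "c < p" "c \<notin> S"
  shows "t c < t b"
proof (rule ccontr)
  assume "\<not> t c < t b"
  then have "max 0 (t b - t c) = 0" "c \<in> {..<p} - S"
    using assms(4,5) by auto
  then have "(\<Prod>c\<in>{..<p} - S. max 0 (t b - t c)) = 0"
    by (intro prod_zero) blast+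
  then have "gap p t S = 0"
    unfolding gap_def using assms(2,3) finite_subset[OF assms(2)] by (intro prod_zero) blast+
  with assms(1) show False
    by simp
qed

text \<open>Two different sets of equal size each have an element outside the other, and
  \<open>t\<close> would have to be larger at each of these two elements than at the other.\<close>

lemma gap_pos_unique:
  assumes "0 < gap p t S" "0 < gap p t S'" "S \<subseteq> {..<p}" "S' \<subseteq> {..<p}" "card S = card S'"
  shows "S = S'"
proof (rule ccontr)
  assume "S \<noteq> S'"
  have fin: "finite S" "finite S'"
    using assms(3,4) by (auto intro: finite_subset)
  then have "\<not> S \<subseteq> S'" "\<not> S' \<subseteq> S"
    using \<open>S \<noteq> S'\<close> assms(5) card_subset_eq by metis+
  then obtain b c where bc: "b \<in> S" "b \<notin> S'" "c \<in> S'" "c \<notin> S"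
    by blast
  then have "b < p" "c < p"
    using assms(3,4) by auto
  then show False
    using gap_posD[OF assms(1,3)] gap_posD[OF assms(2,4)] bc by (meson less_asym)
qed

lemma bij_betw_Suc_mod:
  assumes "0 < p"
  shows "bij_betw (\<lambda>b. Suc b mod p) {..<p} {..<p}"
proof -
  have inj: "inj_on (\<lambda>b. Suc b mod p) {..<p}"
    by (rule inj_onI) (auto simp: mod_Suc split: if_splits)
  have "(\<lambda>b. Suc b mod p) ` {..<p} = {..<p}"
    by (rule endo_inj_surj[OF _ _ inj]) (use assms in auto)
  with inj show ?thesis
    by (simp add: bij_betw_def)
qed

text \<open>Rotation permutes \<open>{..<p}\<close>, so both products can be reindexed. This carries
  the action of \<open>T\<close> on orbits over to sets of positions.\<close>

lemma gap_Suc_mod: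
  assumes "0 < p" "S \<subseteq> {..<p}"
  shows "gap p t ((\<lambda>b. Suc b mod p) ` S) = gap p (\<lambda>b. t (Suc b mod p)) S"
proof -
  let ?r = "\<lambda>b. Suc b mod p"
  have inj: "inj_on ?r {..<p}" and img: "?r ` {..<p} = {..<p}"
    using bij_betw_Suc_mod[OF assms(1)] by (auto simp: bij_betw_def)
  have compl: "{..<p} - ?r ` S = ?r ` ({..<p} - S)"
    using inj_on_image_set_diff[OF inj _ assms(2), of "{..<p}"] img by simp
  have injs: "inj_on ?r S" "inj_on ?r ({..<p} - S)"
    using inj assms(2) by (auto intro: inj_on_subset)
  show ?thesis
    unfolding gap_def compl by (simp add: prod.reindex[OF injs(1)] prod.reindex[OF injs(2)])
qed

lemma bij_betw_residue_subsets:
  assumes "0 < p"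
  shows "bij_betw ((`) (\<lambda>b. Suc b mod p)) (residue_subsets p k a) (residue_subsets p k (Suc a mod p))"
  unfolding residue_subsets_def
proof (rule bij_betw_Collect[OF bij_betw_Pow[OF bij_betw_Suc_mod[OF assms]]])
  let ?r = "\<lambda>b. Suc b mod p"
  fix S assume "S \<in> Pow {..<p}"
  then have inj: "inj_on ?r S"
    using bij_betw_Suc_mod[OF assms] by (auto simp: bij_betw_def intro: inj_on_subset)
  have "[\<Sum>(?r ` S) = (\<Sum>b\<in>S. Suc b)] (mod p)"
    unfolding sum.reindex[OF inj] by (intro cong_sum) (simp add: cong_def)
  also have "(\<Sum>b\<in>S. Suc b) = \<Sum>S + card S"
    by (simp add: sum_Suc)
  finally have 1: "[\<Sum>(?r ` S) = \<Sum>S + card S] (mod p)" .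
  have 2: "[k * (Suc a mod p) = k * a + k] (mod p)"
    unfolding cong_def by (simp add: mod_mult_right_eq add.commute)
  have "[\<Sum>(?r ` S) = k * (Suc a mod p)] (mod p) \<longleftrightarrow> [\<Sum>S + k = k * a + k] (mod p)" if "card S = k"
    using 1 2 that by (metis cong_sym cong_trans)
  then show "(card (?r ` S) = k \<and> [\<Sum>(?r ` S) = k * (Suc a mod p)] (mod p)) \<longleftrightarrow>
      (card S = k \<and> [\<Sum>S = k * a] (mod p))"
    unfolding card_image[OF inj] by (auto simp: cong_add_rcancel_nat)
qed

text \<open>Row \<open>i * (p - 1) + (k - 1)\<close> stands for the function \<open>f i\<close> and
  the sets of \<open>k\<close> positions, \<open>0 < k < p\<close>, and the column for the label of
  the set; \<open>idx\<close> and \<open>sz\<close> decode the row. At most one set per row has a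
  positive gap, hence at most one column is positive.\<close>

lemma maps_to_join:
  fixes f :: "nat \<Rightarrow> 'a \<Rightarrow> real"
  assumes p: "prime p" and T: "continuous_map X X T"
    and f: "\<And>i. i < M \<Longrightarrow> continuous_map X euclideanreal (f i)"
    and sep: "\<And>x. x \<in> topspace X \<Longrightarrow> \<exists>i<M. f i x \<noteq> f i (T x)"
  shows "\<exists>F. equivariant_map (periodic_points X T p) T
    (realization (join_complex p (M * (p - 1)))) (\<lambda>x. x \<circ> shift p) F"
proof -
  define N where "N = M * (p - 1)"
  have p2: "2 \<le> p" and p0: "0 < p"
    using prime_ge_2_nat[OF p] by auto
  define P where "P = {x \<in> topspace X. (T ^^ p) x = x}"
  have top: "topspace (periodic_points X T p) = P"
    by (auto simp: periodic_points_def P_def)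
  define orbit where "orbit i x b = f i ((T ^^ b) x)" for i x b
  define idx where "idx v = v div p div (p - 1)" for v
  define sz where "sz v = v div p mod (p - 1) + 1" for v
  define G where "G v x = (\<Sum>S\<in>residue_subsets p (sz v) (v mod p). gap p (orbit (idx v) x) S)" for v x
  have T_funpow: "continuous_map X X (T ^^ b)" for b
  proof (induction b)
    case (Suc b)
    from continuous_map_compose[OF Suc T] show ?case
      unfolding funpow.simps .
  qed (simp flip: id_def)
  have sz: "0 < sz v" "sz v < p" for v
  proof -
    have "v div p mod (p - 1) < p - 1"
      using p2 by simp
    then show "0 < sz v" "sz v < p"
      unfolding sz_def by linarith+
  qed
  have idx: "idx v < M" if "v < N * p" for v
    using that by (simp add: idx_def N_def less_mult_imp_div_less)
  have G_nonneg: "0 \<le> G v x" for v x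
    unfolding G_def by (intro sum_nonneg gap_nonneg)
  have G_cont: "continuous_map (periodic_points X T p) euclideanreal (G v)" if "v < N * p" for v
  proof -
    have "continuous_map X euclideanreal (\<lambda>x. orbit (idx v) x b)" for b
      using continuous_map_compose[OF T_funpow f[OF idx[OF that]]] by (simp add: orbit_def comp_def)
    moreover have "finite S" if "S \<in> residue_subsets p (sz v) (v mod p)" for S
      using that finite_subset by (auto simp: residue_subsets_def)
    ultimately show ?thesis
      unfolding G_def gap_def periodic_points_def
      by (intro continuous_map_from_subtopology continuous_map_sum continuous_map_prod
          continuous_map_real_max continuous_map_diff finite_residue_subsets) simp_all
  qed
  have G_posD: "\<exists>S\<in>residue_subsets p (sz v) (v mod p). 0 < gap p (orbit (idx v) x) S"
    if "0 < G v x" for v x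
  proof (rule ccontr)
    assume "\<not> ?thesis"
    then have "G v x \<le> 0"
      unfolding G_def by (intro sum_nonpos) (simp add: not_less)
    with that show False
      by simp
  qed
  have G_pos: "\<exists>v<N * p. 0 < G v x" if x: "x \<in> P" for x
  proof -
    obtain i where i: "i < M" "orbit i x 0 \<noteq> orbit i x 1"
      using sep x by (auto simp: P_def orbit_def)
    \<comment> \<open>The positions of the maximum form a proper subset, since the orbit takes
      different values at \<open>0\<close> and \<open>1\<close>.\<close>
    define m where "m = Max (orbit i x ` {..<p})"
    define S where "S = {b \<in> {..<p}. orbit i x b = m}"
    have le: "orbit i x b \<le> m" if "b < p" for b
      unfolding m_def using that by (intro Max_ge) auto
    have "m \<in> orbit i x ` {..<p}"
      unfolding m_def using p0 by (intro Max_in) auto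
    then have "S \<noteq> {}"
      by (auto simp: S_def)
    moreover have "S \<noteq> {..<p}"
    proof
      assume "S = {..<p}"
      then have "0 \<in> S" "1 \<in> S"
        using p2 by auto
      then show False
        using i by (simp add: S_def)
    qed
    ultimately have "0 < card S" "card S < p"
      using psubset_card_mono[of "{..<p}" S] by (auto simp: S_def card_gt_0_iff)
    then have "coprime (card S) p"
      using p by (metis coprime_commute nat_dvd_not_less prime_imp_coprime_nat)
    \<comment> \<open>\<open>e\<close> inverts the size of \<open>S\<close> modulo \<open>p\<close>,
      so \<open>e * \<Sum>S mod p\<close> is the label of \<open>S\<close>.\<close>
    then obtain e where e: "[card S * e = 1] (mod p)"
      using cong_solve_coprime_nat unfolding One_nat_def by blast
    define a where "a = e * \<Sum>S mod p"
    have "[card S * a = card S * e * \<Sum>S] (mod p)"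
      by (simp add: a_def cong_def mod_mult_right_eq mult.assoc)
    also have "[card S * e * \<Sum>S = 1 * \<Sum>S] (mod p)"
      by (intro cong_mult e cong_refl)
    finally have sum: "[\<Sum>S = card S * a] (mod p)"
      by (simp add: cong_sym)
    define v where "v = (i * (p - 1) + (card S - 1)) * p + a"
    have "a < p"
      using p0 by (simp add: a_def)
    then have v: "v div p = i * (p - 1) + (card S - 1)" "v mod p = a"
      by (simp_all add: v_def)
    have "card S - 1 < p - 1"
      using \<open>0 < card S\<close> \<open>card S < p\<close> by linarith
    moreover have "(i * (p - 1) + r) div (p - 1) = i" "(i * (p - 1) + r) mod (p - 1) = r"
      if "r < p - 1" for r
      using that by simp_all
    ultimately have idx_v: "idx v = i" and sz_v: "sz v = card S"
      unfolding idx_def sz_def v using \<open>0 < card S\<close> by (blast, metis Suc_pred' Suc_eq_plus1)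
    have "v div p < (i + 1) * (p - 1)"
      using \<open>card S - 1 < p - 1\<close> by (simp add: v)
    also have "\<dots> \<le> N"
      unfolding N_def using i by (intro mult_right_mono) auto
    finally have "v < N * p"
      using p0 by (simp add: div_less_iff_less_mult)
    moreover have "0 < gap p (orbit i x) S"
      using le by (intro gap_posI) (auto simp: S_def order_le_less)
    then have "0 < G v x"
      unfolding G_def sz_v idx_v v(2) using sum
      by (intro sum_pos2[of _ S] finite_residue_subsets gap_nonneg)
        (auto simp: residue_subsets_def S_def)
    ultimately show ?thesis
      by blast
  qed
  have G_disj: "v = w" if G: "0 < G v x" "0 < G w x" and row: "v div p = w div p" for v w x
  proof -
    have eq: "sz v = sz w" "idx v = idx w"
      by (simp_all add: sz_def idx_def row)
    obtain S S' where S: "S \<in> residue_subsets p (sz w) (v mod p)" "0 < gap p (orbit (idx w) x) S"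
      and S': "S' \<in> residue_subsets p (sz w) (w mod p)" "0 < gap p (orbit (idx w) x) S'"
      using G_posD[OF G(1)] G_posD[OF G(2)] unfolding eq by blast
    have "S = S'"
      using gap_pos_unique[OF S(2) S'(2)] S(1) S'(1) by (simp add: residue_subsets_def)
    then have "[\<Sum>S = sz w * (v mod p)] (mod p)" "[\<Sum>S = sz w * (w mod p)] (mod p)"
      using S(1) S'(1) unfolding residue_subsets_def by blast+
    then have "[sz w * (v mod p) = sz w * (w mod p)] (mod p)"
      using cong_sym cong_trans by blast
    moreover have "coprime (sz w) p"
      using p sz by (metis coprime_commute nat_dvd_not_less prime_imp_coprime_nat)
    ultimately have "[v mod p = w mod p] (mod p)"
      by (simp add: cong_mult_lcancel_nat)
    then show "v = w"
      by - (rule div_mod_eqI[OF row], simp add: cong_def)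
  qed
  \<comment> \<open>Replacing \<open>x\<close> by \<open>T x\<close> rotates the orbit sequence,
    which wraps around because \<open>(T ^^ p) x = x\<close>, and rotating a set raises its label by
    one.\<close>
  have G_shift: "G v (T x) = G (shift p v) x" if x: "x \<in> P" for v x
  proof -
    have orbit: "orbit i (T x) b = orbit i x (Suc b mod p)" if "b < p" for i b
    proof (cases "Suc b = p")
      case True
      then have "(T ^^ Suc b) x = x"
        using x by (simp add: P_def del: funpow.simps)
      then have "(T ^^ b) (T x) = x"
        by (simp only: funpow_Suc_right comp_apply)
      then show ?thesis
        using True by (simp add: orbit_def)
    qed (use that in \<open>simp add: orbit_def funpow_swap1\<close>)
    have gap_eq: "gap p (orbit i (T x)) S = gap p (orbit i x) ((\<lambda>b. Suc b mod p) ` S)" if "S \<subseteq> {..<p}" for i S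
      unfolding gap_Suc_mod[OF p0 that] unfolding gap_def using orbit that
      by (intro prod.cong refl) (auto simp: subset_iff)
    have eq: "sz (shift p v) = sz v" "idx (shift p v) = idx v" "shift p v mod p = Suc (v mod p) mod p"
      using p0 by (simp_all add: sz_def idx_def shift_div shift_mod)
    have "G v (T x) = (\<Sum>S\<in>residue_subsets p (sz v) (v mod p).
        gap p (orbit (idx v) x) ((\<lambda>b. Suc b mod p) ` S))"
      unfolding G_def by (intro sum.cong gap_eq refl) (simp add: residue_subsets_def)
    also have "\<dots> = G (shift p v) x"
      unfolding G_def eq by (rule sum.reindex_bij_betw[OF bij_betw_residue_subsets[OF p0]])
    finally show ?thesis .
  qed
  define F where "F x v = (if v < N * p then G v x / (\<Sum>w<N * p. G w x) else 0)" for x v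
  have "continuous_map (periodic_points X T p) (realization (join_complex p N)) F"
    unfolding F_def by (rule continuous_map_normalize) (use G_cont G_nonneg G_pos G_disj in \<open>auto simp: top\<close>)
  moreover have "F (T x) = F x \<circ> shift p" if x: "x \<in> P" for x
  proof -
    have "(\<Sum>w<N * p. G w (T x)) = (\<Sum>w<N * p. G (shift p w) x)"
      by (simp add: G_shift[OF x])
    also have "\<dots> = (\<Sum>w<N * p. G w x)"
      by (rule sum.reindex_bij_betw[OF bij_betw_shift[OF p0]])
    finally show ?thesis
      by (auto simp: F_def G_shift[OF x] shift_less_iff[OF p0])
  qed
  ultimately show ?thesis
    unfolding equivariant_map_def top N_def by blast
qed

lemma ind_less:
  assumes "maps_to_EnZp n p Y S"
  shows "\<bar>ind p Y S\<bar> \<noteq> \<infinity>" "ind p Y S < ereal (real n + 1)"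
proof -
  have "(LEAST n. maps_to_EnZp n p Y S) \<le> n"
    using assms by (rule Least_le)
  then show "\<bar>ind p Y S\<bar> \<noteq> \<infinity>" "ind p Y S < ereal (real n + 1)"
    using assms by (auto simp: ind_def one_ereal_def)
qed

theorem theorem1p2:
  fixes X :: "'a topology" and T :: "'a \<Rightarrow> 'a"
  assumes "dynamical_system X T"
    and "fixed_point_free X T"
  shows "(\<forall>p::nat. prime p \<longrightarrow> \<bar>ind p (periodic_points X T p) T\<bar> \<noteq> \<infinity>) \<and>
    (\<exists>C::real. C > 0 \<and>
      (\<forall>p::nat. prime p \<longrightarrow> ind p (periodic_points X T p) T < ereal (C * real p)))"
proof -
  have T: "continuous_map X X T"
    using assms(1) by (simp add: dynamical_system_def homeomorphic_imp_continuous_map)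
  obtain M :: nat and f :: "nat \<Rightarrow> 'a \<Rightarrow> real"
    where f: "\<And>i. i < M \<Longrightarrow> continuous_map X euclideanreal (f i)"
      and sep: "\<And>x. x \<in> topspace X \<Longrightarrow> \<exists>i<M. f i x \<noteq> f i (T x)"
  proof -
    show thesis
      by (rule separating_functions[OF assms]) (fact that)
  qed
  \<comment> \<open>The join of \<open>M * (p - 1)\<close> copies bounds the index by
    \<open>M * (p - 1) - 1\<close>. The constant \<open>M + 1\<close> is positive also for
    \<open>M = 0\<close>, which is possible only if \<open>X\<close> is empty.\<close>
  have main: "\<bar>ind p (periodic_points X T p) T\<bar> \<noteq> \<infinity> \<and>
      ind p (periodic_points X T p) T < ereal ((real M + 1) * real p)" if p: "prime p" for p
  proof (cases "topspace (periodic_points X T p) = {}")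
    case True
    have "0 \<le> (real M + 1) * real p"
      by simp
    then have "-1 < (real M + 1) * real p"
      by linarith
    with True show ?thesis
      by (simp add: ind_def one_ereal_def)
  next
    case False
    define n where "n = M * (p - 1) - 1"
    have p2: "2 \<le> p"
      using prime_ge_2_nat[OF p] .
    obtain x where "x \<in> topspace X"
      using False by (auto simp: periodic_points_def)
    from sep[OF this] have "0 < M"
      by (elim exE conjE) simp
    then have N: "0 < M * (p - 1)"
      using p2 by simp
    have "maps_to_EnZp n p (periodic_points X T p) T"
      unfolding maps_to_EnZp_def n_def
      using EnZp_space_join[OF _ N, of p] maps_to_join[OF p T f sep] p2 by fastforce
    note ind = ind_less[OF this]
    have "n + 1 = M * (p - 1)"
      using N by (simp add: n_def)
    then have "real n + 1 = real M * real (p - 1)"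
      by (metis of_nat_1 of_nat_add of_nat_mult)
    also have "\<dots> \<le> (real M + 1) * real p"
      by (intro mult_mono) auto
    finally show ?thesis
      using ind by (meson ereal_less_eq(3) order_less_le_trans)
  qed
  show ?thesis
  proof (intro conjI exI[of _ "real M + 1"] allI impI)
    show "\<bar>ind p (periodic_points X T p) T\<bar> \<noteq> \<infinity>" if "prime p" for p
      using main[OF that] ..
    show "ind p (periodic_points X T p) T < ereal ((real M + 1) * real p)" if "prime p" for p
      using main[OF that] ..
  qed simp
qed

end
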